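(* There exists a real analytic curve $f:(0,1)\to\mathbb{R}^2$ such that the image of $f$ does not lie between any two parallel lines and the Borel chromatic number of the Cayley graph of $\mathbb{R}^2$ with respect to $\{\pm f(s):0<s<1\}$ is finite.
   Context: For a symmetric set $S\subseteq\mathbb{R}^2$ not containing $0$, the Cayley graph $\mathrm{Cay}(\mathbb{R}^2,S)$ has vertex set $\mathbb{R}^2$, with $x,y$ adjacent iff $x-y\in S$. Its Borel chromatic number is the least cardinal $c$ such that $\mathbb{R}^2$ can be partitioned into $c$ Borel sets none of which contains two adjacent vertices. *)

theory Defs
  imports "HOL-Analysis.Analysis" "HOL-Library.Disjoint_Sets"
begin

unbundle cardinal_syntax

definition real_analytic_on :: "(real \<Rightarrow> 'a::real_normed_vector) \<Rightarrow> real set \<Rightarrow> bool"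
    (infix \<open>real'_analytic'_on\<close> 50) where
  "f real_analytic_on I \<longleftrightarrow>
     (\<forall>s\<in>I. \<exists>r>0. \<exists>a :: nat \<Rightarrow> 'a.
        \<forall>t\<in>I. \<bar>t - s\<bar> < r \<longrightarrow> (\<lambda>k. (t - s) ^ k *\<^sub>R a k) sums f t)"

text \<open>With \<^term>\<open>u \<noteq> (0::real^2)\<close>, the sets \<^term>\<open>{x::real^2. u \<bullet> x = a}\<close> and
  \<^term>\<open>{x::real^2. u \<bullet> x = b}\<close> are two parallel lines, and every pair of parallel lines
  arises in this way. The lines themselves are included in the region between them.\<close>

definition between_parallel_lines :: "(real^2) set \<Rightarrow> bool" where
  "between_parallel_lines X \<longleftrightarrow>
     (\<exists>u a b. u \<noteq> 0 \<and> X \<subseteq> {x. a \<le> u \<bullet> x \<and> u \<bullet> x \<le> b})"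

text \<open>A graph is represented by its adjacency relation; the vertices are all elements of the type.\<close>

definition cayley_graph :: "'a::ab_group_add set \<Rightarrow> ('a \<times> 'a) set" where
  "cayley_graph S = {(x, y). x - y \<in> S}"

definition borel_coloring :: "('a::topological_space \<times> 'a) set \<Rightarrow> 'a set set \<Rightarrow> bool" where
  "borel_coloring G P \<longleftrightarrow>
     partition_on UNIV P \<and>
     (\<forall>B\<in>P. B \<in> sets borel \<and> (\<forall>x\<in>B. \<forall>y\<in>B. (x, y) \<notin> G))"

text \<open>Cardinals are HOL cardinal orders, unique up to \<open>=o\<close>; hence the Borel chromatic number
  is a relation between a graph and a cardinal order.\<close>

definition is_borel_chromatic_number ::
    "('a::topological_space \<times> 'a) set \<Rightarrow> 'a set rel \<Rightarrow> bool" where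
  "is_borel_chromatic_number G c \<longleftrightarrow>
     Card_order c \<and>
     (\<exists>P. borel_coloring G P \<and> |P| =o c) \<and>
     (\<forall>P. borel_coloring G P \<longrightarrow> c \<le>o |P| )"

end

theory Submission
  imports Defs "HOL-Complex_Analysis.Cauchy_Integral_Formula"
begin

text \<open>Colour the plane by the cell of the torus \<open>\<real>\<^sup>2/\<int>\<^sup>2\<close>, divided into a \<open>4 \<times> 4\<close> grid,
  that contains a point. Two points of the same colour differ by a vector both of whose coordinates
  are closer than 1/4 to an integer, so it suffices to find an analytic curve that avoids such
  vectors and is unbounded in every direction. With \<open>t = 1/s\<close>, the curve
  \<open>(t, 1/2 + t exp (- t\<^sup>2 (1 + cos (2 \<pi> t))) / 4)\<close> works: if \<open>t\<close> is near an integer, the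
  exponential forces the second coordinate into \<open>[1/2, 3/4]\<close>, while at half-integers the
  exponential is 1 and the second coordinate is large.\<close>

section \<open>Real analyticity from complex power series\<close>

text \<open>Since \<open>t - s\<close> is real, taking real parts term by term in the Taylor series
  of \<open>F\<close> at \<open>s\<close> leaves a real power series in
  \<open>t - s\<close>.\<close>

lemma real_analytic_on_Re_holomorphic:
  assumes "open A" "F holomorphic_on A"
    and "\<And>t. t \<in> I \<Longrightarrow> complex_of_real t \<in> A"
    and "\<And>t. t \<in> I \<Longrightarrow> f t = Re (F (of_real t))"
  shows "f real_analytic_on I"
  unfolding real_analytic_on_def
proof
  fix s assume "s \<in> I"
  then obtain r where r: "r > 0" "ball (of_real s) r \<subseteq> A"
    using assms(1,3) open_contains_ball by blast
  let ?c = "\<lambda>k. (deriv ^^ k) F (of_real s) / fact k"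
  have "(\<lambda>k. (t - s) ^ k *\<^sub>R Re (?c k)) sums f t" if t: "t \<in> I" "\<bar>t - s\<bar> < r" for t
  proof -
    have "(\<lambda>k. ?c k * (of_real t - of_real s) ^ k) sums F (of_real t)"
    proof (rule holomorphic_power_series)
      show "F holomorphic_on ball (of_real s) r"
        using assms(2) r(2) holomorphic_on_subset by blast
      show "complex_of_real t \<in> ball (of_real s) r"
        using t(2) by (simp add: dist_norm abs_minus_commute flip: of_real_diff)
    qed
    then have "(\<lambda>k. Re (?c k * (of_real t - of_real s) ^ k)) sums Re (F (of_real t))"
      by (rule sums_Re)
    moreover have "Re (c * (of_real t - of_real s) ^ k) = (t - s) ^ k *\<^sub>R Re c" for c k
    proof -
      have "(of_real t - of_real s) ^ k = complex_of_real ((t - s) ^ k)"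
        by simp
      then show ?thesis
        by (simp only: times_complex.sel Re_complex_of_real Im_complex_of_real) simp
    qed
    ultimately show ?thesis
      by (simp only: assms(4)[OF t(1)])
  qed
  then have "\<forall>t\<in>I. \<bar>t - s\<bar> < r \<longrightarrow> (\<lambda>k. (t - s) ^ k *\<^sub>R Re (?c k)) sums f t"
    by blast
  with r(1) show "\<exists>r>0. \<exists>a. \<forall>t\<in>I. \<bar>t - s\<bar> < r \<longrightarrow> (\<lambda>k. (t - s) ^ k *\<^sub>R a k) sums f t"
    by (intro exI[of _ r] conjI exI[of _ "\<lambda>k. Re (?c k)"])
qed

lemma real_analytic_on_componentwise:
  fixes f :: "real \<Rightarrow> real^'n"
  assumes "\<And>i. (\<lambda>t. f t $ i) real_analytic_on I"
  shows "f real_analytic_on I"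
  unfolding real_analytic_on_def
proof
  fix s assume "s \<in> I"
  then have "\<forall>i. \<exists>r>0. \<exists>a. \<forall>t\<in>I. \<bar>t - s\<bar> < r \<longrightarrow> (\<lambda>k. (t - s) ^ k *\<^sub>R a k) sums (f t $ i)"
    using assms unfolding real_analytic_on_def by blast
  then obtain r a where r: "\<And>i. r i > 0"
    and a: "\<And>i t. t \<in> I \<Longrightarrow> \<bar>t - s\<bar> < r i \<Longrightarrow> (\<lambda>k. (t - s) ^ k *\<^sub>R a i k) sums (f t $ i)"
    by metis
  \<comment> \<open>There are finitely many coordinates, so the least radius is positive and serves
    all of them.\<close>
  let ?r = "Min (range r)" and ?a = "\<lambda>k. \<chi> i. a i k"
  have "(\<lambda>k. (t - s) ^ k *\<^sub>R ?a k) sums f t" if "t \<in> I" "\<bar>t - s\<bar> < ?r" for t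
    unfolding sums_def
  proof (rule vec_tendstoI)
    fix i
    have "\<bar>t - s\<bar> < r i"
      using that(2) by simp
    from a[OF that(1) this]
    show "(\<lambda>n. (\<Sum>k<n. (t - s) ^ k *\<^sub>R ?a k) $ i) \<longlonglongrightarrow> f t $ i"
      by (simp add: sums_def)
  qed
  then have "\<forall>t\<in>I. \<bar>t - s\<bar> < ?r \<longrightarrow> (\<lambda>k. (t - s) ^ k *\<^sub>R ?a k) sums f t"
    by blast
  moreover have "?r > 0"
    using r by simp
  ultimately show "\<exists>r>0. \<exists>a. \<forall>t\<in>I. \<bar>t - s\<bar> < r \<longrightarrow> (\<lambda>k. (t - s) ^ k *\<^sub>R a k) sums f t"
    by (intro exI[of _ ?r] conjI exI[of _ ?a])
qed

section \<open>Borel colourings with finitely many colours\<close>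

text \<open>Cardinals are well-ordered, so some colouring has least size; that size is at most
  \<open>|P|\<close>, hence finite.\<close>

lemma finite_borel_chromatic_number:
  fixes G :: "('a::topological_space \<times> 'a) set"
  assumes "borel_coloring G P" "finite P"
  shows "\<exists>c. is_borel_chromatic_number G c \<and> finite (Field c)"
proof -
  let ?R = "{|Q| | Q. borel_coloring G Q}"
  have "?R \<noteq> {}" "\<forall>r\<in>?R. Card_order r"
    using assms(1) card_of_Card_order by auto
  from exists_minim_Card_order[OF this]
  obtain c where c: "c \<in> ?R" "\<forall>r\<in>?R. c \<le>o r"
    by (rule bexE)
  then obtain Q where Q: "borel_coloring G Q" "c = |Q|"
    by blast
  have "is_borel_chromatic_number G c"
    unfolding is_borel_chromatic_number_def
    using c(2) Q by (auto simp: card_of_Card_order intro: card_of_refl)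
  moreover have "|Q| \<le>o |P|"
    using c(2) Q(2) assms(1) by blast
  then have "finite Q"
    using assms(2) card_of_ordLeq_finite by blast
  ultimately show ?thesis
    using Q(2) by (auto simp: Field_card_of)
qed

text \<open>Only colours in \<open>range \<kappa>\<close> are taken, because an empty fibre could
  not be a block of a partition.\<close>

lemma borel_coloring_fibres:
  fixes \<kappa> :: "'a::topological_space \<Rightarrow> 'b"
  assumes "\<kappa> \<in> measurable borel (count_space UNIV)"
    and "\<And>x y. (x, y) \<in> G \<Longrightarrow> \<kappa> x \<noteq> \<kappa> y"
  shows "borel_coloring G ((\<lambda>k. \<kappa> -` {k}) ` range \<kappa>)"
  unfolding borel_coloring_def
proof (intro conjI ballI)
  show "partition_on UNIV ((\<lambda>k. \<kappa> -` {k}) ` range \<kappa>)"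
    by (auto simp: partition_on_def disjoint_def)
next
  fix B assume "B \<in> (\<lambda>k. \<kappa> -` {k}) ` range \<kappa>"
  then show "B \<in> sets borel"
    using measurable_sets[OF assms(1)] by auto
next
  fix B x y assume "B \<in> (\<lambda>k. \<kappa> -` {k}) ` range \<kappa>" "x \<in> B" "y \<in> B"
  then have "\<kappa> x = \<kappa> y"
    by auto
  then show "(x, y) \<notin> G"
    using assms(2) by blast
qed

definition torus_cell :: "real^2 \<Rightarrow> int \<times> int" where
  "torus_cell v = (\<lfloor>4 * v $ 1\<rfloor> mod 4, \<lfloor>4 * v $ 2\<rfloor> mod 4)"

lemma finite_range_torus_cell: "finite (range torus_cell)"
  by (rule finite_subset[of _ "{0..<4} \<times> {0..<4}"]) (auto simp: torus_cell_def)

lemma measurable_torus_cell: "torus_cell \<in> measurable borel (count_space UNIV)"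
proof -
  have [measurable]: "(\<lambda>v::real^2. v $ i) \<in> borel_measurable borel" for i
    by (intro borel_measurable_continuous_onI continuous_intros)
  show ?thesis
    unfolding torus_cell_def by measurable
qed

text \<open>The floors differ by some \<open>4 * n\<close>, and the fractional parts of
  \<open>4 * a\<close> and \<open>4 * b\<close> differ by strictly less than 1; divide by 4.\<close>

lemma floor_mod_eq_imp_near_int:
  fixes a b :: real
  assumes "\<lfloor>4 * a\<rfloor> mod 4 = \<lfloor>4 * b\<rfloor> mod (4::int)"
  shows "\<exists>n::int. \<bar>(a - b) - of_int n\<bar> < 1/4"
proof -
  obtain n where n: "\<lfloor>4 * a\<rfloor> - \<lfloor>4 * b\<rfloor> = 4 * n"
    using assms by (meson mod_eq_dvd_iff dvdE)
  then have "real_of_int \<lfloor>4 * a\<rfloor> - of_int \<lfloor>4 * b\<rfloor> = 4 * of_int n"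
    by linarith
  moreover have "of_int \<lfloor>4 * a\<rfloor> \<le> 4 * a" "4 * a < of_int \<lfloor>4 * a\<rfloor> + 1"
    "of_int \<lfloor>4 * b\<rfloor> \<le> 4 * b" "4 * b < of_int \<lfloor>4 * b\<rfloor> + 1"
    by linarith+
  ultimately show ?thesis
    by (intro exI[of _ n]) linarith
qed

section \<open>The analytic curve\<close>

text \<open>The factor \<open>1 + cos (2 * pi * t)\<close> vanishes exactly at half-integers and is
  at least 1 within 1/4 of an integer; there the square in the exponent outweighs the factor
  \<open>t\<close>.\<close>

definition height :: "real \<Rightarrow> real" where
  "height t = 1/2 + t * exp (- (t\<^sup>2 * (1 + cos (2 * pi * t)))) / 4"

lemma height_near_int:
  assumes "t > 0" "\<bar>t - of_int n\<bar> < 1/4"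
  shows "1/2 \<le> height t" "height t \<le> 3/4"
proof -
  show "1/2 \<le> height t"
    using assms(1) by (simp add: height_def)
  have "2 * pi * t = 2 * pi * (t - of_int n) + 2 * pi * of_int n"
    by (simp add: algebra_simps)
  then have "cos (2 * pi * t) = cos (2 * pi * (t - of_int n))"
    by (simp add: cos_add)
  also have "\<dots> \<ge> 0"
  proof (rule cos_ge_zero)
    \<comment> \<open>Distance 1/4 from an integer is a quarter of a period, where the cosine
      reaches 0.\<close>
    have "\<bar>2 * pi * (t - of_int n)\<bar> \<le> pi / 2"
      using mult_left_mono[of "\<bar>t - of_int n\<bar>" "1/4" "2 * pi"] assms(2) by (simp add: abs_mult)
    then show "- (pi / 2) \<le> 2 * pi * (t - of_int n)" "2 * pi * (t - of_int n) \<le> pi / 2"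
      by (simp_all only: abs_le_iff) linarith
  qed
  finally have "exp (- (t\<^sup>2 * (1 + cos (2 * pi * t)))) \<le> exp (- (t\<^sup>2))"
    by (simp add: algebra_simps)
  then have "t * exp (- (t\<^sup>2 * (1 + cos (2 * pi * t)))) \<le> t * exp (- (t\<^sup>2))"
    using assms(1) by simp
  also have "t \<le> exp (t\<^sup>2)"
  proof -
    \<comment> \<open>Expanding the square of \<open>t - 1/2\<close> gives
      \<open>t \<le> t\<^sup>2 + 1/4\<close>.\<close>
    have "t \<le> 1 + t\<^sup>2"
      using sum_squares_ge_zero[of "t - 1/2" 0] by (simp add: power2_eq_square algebra_simps)
    also have "\<dots> \<le> exp (t\<^sup>2)"
      by (rule exp_ge_add_one_self)
    finally show ?thesis .
  qed
  then have "t * exp (- (t\<^sup>2)) \<le> 1"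
    by (simp add: exp_minus divide_simps)
  finally show "height t \<le> 3/4"
    by (simp add: height_def)
qed

lemma height_half_int: "height (real n + 1/2) = 1/2 + (real n + 1/2) / 4"
proof -
  have "2 * pi * (real n + 1/2) = 2 * pi * real n + pi"
    by (simp add: algebra_simps)
  moreover have "cos (2 * pi * real n) = 1"
    by (metis cos_2npi mult.assoc mult.commute)
  ultimately show ?thesis
    by (simp add: height_def)
qed

definition curve :: "real \<Rightarrow> real^2" where
  "curve s = vector [1 / s, height (1 / s)]"

lemma curve_nth [simp]: "curve s $ 1 = 1 / s" "curve s $ 2 = height (1 / s)"
  by (simp_all add: curve_def)

lemma curve_real_analytic: "curve real_analytic_on {0<..<1}"
proof (rule real_analytic_on_componentwise)
  fix i :: 2
  have "(\<lambda>s. 1 / s) real_analytic_on {0<..<1}"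
    by (rule real_analytic_on_Re_holomorphic[of "- {0}" "\<lambda>z. 1 / z"])
       (auto intro!: holomorphic_intros)
  moreover have "(\<lambda>s. height (1 / s)) real_analytic_on {0<..<1}"
  \<comment> \<open>The witness is the formula for \<open>height (1 / s)\<close> read at a complex
    argument; its only singularity, 0, lies outside the parameter interval.\<close>
  proof (rule real_analytic_on_Re_holomorphic
      [of "- {0}" "\<lambda>z. 1/2 + 1/z * exp (- ((1/z)\<^sup>2 * (1 + cos (2 * of_real pi * (1/z))))) / 4"])
    fix t :: real
    have "1/2 + 1 / complex_of_real t *
        exp (- ((1 / of_real t)\<^sup>2 * (1 + cos (2 * of_real pi * (1 / of_real t))))) / 4
      = of_real (height (1 / t))"
      by (simp add: height_def flip: cos_of_real exp_of_real)
    then show "height (1 / t) = Re (1/2 + 1 / complex_of_real t *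
        exp (- ((1 / of_real t)\<^sup>2 * (1 + cos (2 * of_real pi * (1 / of_real t))))) / 4)"
      by (simp only: Re_complex_of_real)
  qed (auto intro!: holomorphic_intros)
  ultimately show "(\<lambda>s. curve s $ i) real_analytic_on {0<..<1}"
    using exhaust_2[of i] by auto
qed

section \<open>Unboundedness in every direction\<close>

text \<open>For \<open>n \<ge> 2\<close> both \<open>n\<close> and \<open>n + 1/2\<close> exceed 1,
  so they are values of \<open>1 / s\<close> with \<open>s\<close> in the parameter
  interval.\<close>

lemma bounded_linear_growth_imp_zero:
  fixes \<alpha> \<beta> :: real
  assumes "\<And>n::nat. n \<ge> 2 \<Longrightarrow> \<bar>\<alpha> * real n\<bar> \<le> \<beta>"
  shows "\<alpha> = 0"
proof (rule ccontr)
  assume "\<alpha> \<noteq> 0"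
  obtain n :: nat where n: "\<beta> / \<bar>\<alpha>\<bar> < real n"
    using reals_Archimedean2 by blast
  have "\<beta> < \<bar>\<alpha>\<bar> * real n"
    using n \<open>\<alpha> \<noteq> 0\<close> by (simp add: field_simps)
  also have "\<dots> \<le> \<bar>\<alpha> * real (n + 2)\<bar>"
    by (simp add: abs_mult mult_left_mono)
  also have "\<dots> \<le> \<beta>"
    by (rule assms) simp
  finally show False by simp
qed

text \<open>Along integers the height stays bounded while the first coordinate grows, which kills
  \<open>u $ 1\<close>; along half-integers the height grows linearly, which then kills
  \<open>u $ 2\<close>.\<close>

lemma curve_not_between_parallel_lines: "\<not> between_parallel_lines (curve ` {0<..<1})"
proof
  assume "between_parallel_lines (curve ` {0<..<1})"
  then obtain u a b where u: "u \<noteq> 0"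
    and ab: "\<And>s. 0 < s \<Longrightarrow> s < 1 \<Longrightarrow> a \<le> u \<bullet> curve s \<and> u \<bullet> curve s \<le> b"
    unfolding between_parallel_lines_def image_subset_iff by fastforce
  have bound: "\<bar>u $ 1 * t + u $ 2 * height t\<bar> \<le> \<bar>a\<bar> + \<bar>b\<bar>" if "t > 1" for t
    using ab[of "1 / t"] that by (auto simp: inner_vec_def sum_2)
  have "u $ 1 = 0"
  proof (rule bounded_linear_growth_imp_zero)
    fix n :: nat assume n: "n \<ge> 2"
    have "\<bar>height (real n)\<bar> \<le> 1"
      using height_near_int[of "real n" "int n"] n by simp
    then have "\<bar>u $ 2 * height (real n)\<bar> \<le> \<bar>u $ 2\<bar>"
      by (simp add: abs_mult mult_left_le)
    then show "\<bar>u $ 1 * real n\<bar> \<le> \<bar>a\<bar> + \<bar>b\<bar> + \<bar>u $ 2\<bar>"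
      using bound[of "real n"] n by linarith
  qed
  \<comment> \<open>At \<open>n + 1/2\<close> the height is \<open>n / 4 + 5/8\<close>: slope 1/4,
    and the constant goes into the bound.\<close>
  have "u $ 2 / 4 = 0"
  proof (rule bounded_linear_growth_imp_zero)
    fix n :: nat assume n: "n \<ge> 2"
    have "\<bar>u $ 2 * (1/2 + (real n + 1/2) / 4)\<bar> \<le> \<bar>a\<bar> + \<bar>b\<bar>"
      using bound[of "real n + 1/2"] n \<open>u $ 1 = 0\<close> by (simp add: height_half_int)
    moreover have "u $ 2 * (1/2 + (real n + 1/2) / 4) = u $ 2 / 4 * real n + u $ 2 * (5/8)"
      by (simp add: field_simps)
    ultimately show "\<bar>u $ 2 / 4 * real n\<bar> \<le> \<bar>a\<bar> + \<bar>b\<bar> + \<bar>u $ 2 * (5/8)\<bar>"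
      by linarith
  qed
  with \<open>u $ 1 = 0\<close> have "u = 0"
    by (simp add: vec_eq_iff forall_2)
  with u show False ..
qed

section \<open>Properness of the colouring\<close>

lemma torus_cell_add_curve:
  assumes "0 < s" "v - w = curve s"
  shows "torus_cell v \<noteq> torus_cell w"
proof
  assume "torus_cell v = torus_cell w"
  then obtain n m :: int where n: "\<bar>(v $ 1 - w $ 1) - of_int n\<bar> < 1/4"
    and m: "\<bar>(v $ 2 - w $ 2) - of_int m\<bar> < 1/4"
    unfolding torus_cell_def using floor_mod_eq_imp_near_int by (metis prod.inject)
  have "v $ 1 - w $ 1 = 1 / s" "v $ 2 - w $ 2 = height (1 / s)"
    using assms(2) by (simp_all flip: vector_minus_component)
  with n m have n: "\<bar>1 / s - of_int n\<bar> < 1/4" and m: "\<bar>height (1 / s) - of_int m\<bar> < 1/4"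
    by simp_all
  have "1/2 \<le> height (1 / s)" "height (1 / s) \<le> 3/4"
    using height_near_int[OF _ n] assms(1) by simp_all
  \<comment> \<open>Strictness matters: \<open>m\<close> lies below 3/4 + 1/4, which is exactly
    1.\<close>
  with m have "0 < real_of_int m" "real_of_int m < 1"
    by linarith+
  then show False
    by simp
qed

theorem theorem1p12:
  shows "\<exists>f :: real \<Rightarrow> real^2.
           f real_analytic_on {0<..<1} \<and>
           \<not> between_parallel_lines (f ` {0<..<1}) \<and>
           0 \<notin> f ` {0<..<1} \<and>
           (\<exists>c. is_borel_chromatic_number
                  (cayley_graph (f ` {0<..<1} \<union> (\<lambda>s. - f s) ` {0<..<1})) c \<and>
                finite (Field c))"
proof (intro exI[of _ curve] conjI)
  let ?G = "cayley_graph (curve ` {0<..<1} \<union> (\<lambda>s. - curve s) ` {0<..<1})"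
  show "curve real_analytic_on {0<..<1}"
    by (rule curve_real_analytic)
  show "\<not> between_parallel_lines (curve ` {0<..<1})"
    by (rule curve_not_between_parallel_lines)
  \<comment> \<open>If \<open>curve s\<close> were 0, the cell of the origin would differ from
    itself.\<close>
  show "0 \<notin> curve ` {0<..<1}"
    using torus_cell_add_curve[of _ 0 0] by fastforce
  have "torus_cell v \<noteq> torus_cell w" if vw: "(v, w) \<in> ?G" for v w
  proof -
    from vw obtain s where s: "0 < s" "v - w = curve s \<or> v - w = - curve s"
      unfolding cayley_graph_def by auto
    \<comment> \<open>Having different colours is symmetric, so the sign is absorbed by swapping the
      two points.\<close>
    then have "v - w = curve s \<or> w - v = curve s"
      by (metis minus_diff_eq minus_minus)
    with s(1) show ?thesis
      using torus_cell_add_curve by metis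
  qed
  then have "borel_coloring ?G ((\<lambda>k. torus_cell -` {k}) ` range torus_cell)"
    by (rule borel_coloring_fibres[OF measurable_torus_cell])
  then show "\<exists>c. is_borel_chromatic_number ?G c \<and> finite (Field c)"
    by (rule finite_borel_chromatic_number) (simp add: finite_range_torus_cell)
qed

end
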